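(* Let $k\geq 1$ and $d \geq 2$ be integers and let $P(X) \in \mathbb{Z}[X]$ be a monic polynomial of degree $d$ with $P(\mathbb{N})\subset \mathbb{N}$. Let $\mathcal{P}_{k,P}=(p_k(P(n)))_{n\geq 0}$ be the subsequence of the $k$-pattern sequence along $(P(n))_{n\geq 0}$. Then $$M(\mathcal{P}_{k,P},N) \gg N^{1/d},$$ where the implied constant depends only on $P$ and $k$; that is, there exist a constant $c>0$ and an integer $N_0$, both depending only on $P$ and $k$, such that $M(\mathcal{P}_{k,P},N)\geq c\,N^{1/d}$ for all integers $N\geq N_0$.
   Context: $\mathbb{N}$ denotes the set of nonnegative integers. Pattern sequences: for $k\geq 1$ and an integer $n\geq 0$, let $s_k(n)$ be the number of (possibly overlapping) occurrences of the block $1\cdots 1$ of $k$ consecutive ones in the binary representation of $n$; i.e. if $n=\sum_{i\geq 0}\varepsilon_i2^i$ with $\varepsilon_i\in\{0,1\}$, then $s_k(n)=\sum_{i\geq 0}\varepsilon_i\varepsilon_{i+1}\cdots\varepsilon_{i+k-1}$. The $k$-pattern sequence is $\mathcal{P}_k=(p_k(n))_{n\geq 0}$ with $p_k(n)=s_k(n)\bmod 2\in\{0,1\}$. (For $k=1$ this is the Thue--Morse sequence, for $k=2$ the Rudin--Shapiro sequence.) Maximum order complexity: let $N\geq 2$ be an integer and $\mathcal{S}=(s_n)_{n\geq 0}$ a sequence over $\{0,1\}$ (identified with $\mathbb{F}_2$). If $(s_0,\ldots,s_{N-2})$ is not constant, the $N$th maximum order complexity $M(\mathcal{S},N)$ is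 the smallest positive integer $M$ such that there is a polynomial $f(x_1,\ldots,x_M)$ over $\mathbb{F}_2$ with $$s_{i+M}=f(s_i,\ldots,s_{i+M-1}),\qquad 0\leq i\leq N-M-1.$$ If $s_i=a$ for all $i=0,\ldots,N-2$ (with $a\in\{0,1\}$), then $M(\mathcal{S},N)=0$ if $s_{N-1}=a$, and $M(\mathcal{S},N)=N-1$ otherwise. *)

theory Defs
  imports
    Complex_Main
    "HOL-Library.Poly_Mapping"
    "HOL-Library.Z2"
    "HOL-Computational_Algebra.Polynomial"
begin

definition block_count :: "nat \<Rightarrow> nat \<Rightarrow> nat" where
  "block_count k n = card {i. \<forall>j<k. Bit_Operations.bit n (i + j)}"

(* The type bit of HOL-Library.Z2 is the field with two elements. *)
definition pattern_seq :: "nat \<Rightarrow> nat \<Rightarrow> bit" where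
  "pattern_seq k n = of_nat (block_count k n mod 2)"

(* Multivariate polynomials: finitely supported maps from monomials (exponent vectors
   of variables indexed by nat) to coefficients. *)
type_synonym 'a mpolynomial = "(nat \<Rightarrow>\<^sub>0 nat) \<Rightarrow>\<^sub>0 'a"

definition mpoly_vars :: "'a::zero mpolynomial \<Rightarrow> nat set" where
  "mpoly_vars f = (\<Union>m\<in>Poly_Mapping.keys f. Poly_Mapping.keys m)"

definition mpoly_eval :: "'a::comm_semiring_1 mpolynomial \<Rightarrow> (nat \<Rightarrow> 'a) \<Rightarrow> 'a" where
  "mpoly_eval f x = (\<Sum>m\<in>Poly_Mapping.keys f.
     Poly_Mapping.lookup f m * (\<Prod>v\<in>Poly_Mapping.keys m. x v ^ Poly_Mapping.lookup m v))"

(* Only meaningful for N \<ge> 2. Variables are numbered 0, ..., M - 1, and the condition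
   i + M < N says i \<le> N - M - 1 without truncated subtraction. The LEAST is
   attained, since the condition on the recurrence is vacuous for M = N. *)
definition max_order_complexity :: "(nat \<Rightarrow> bit) \<Rightarrow> nat \<Rightarrow> nat" where
  "max_order_complexity s N =
    (if \<exists>a. \<forall>i\<le>N - 2. s i = a
     then if s (N - 1) = s 0 then 0 else N - 1
     else (LEAST M. 0 < M \<and>
       (\<exists>f :: bit mpolynomial. mpoly_vars f \<subseteq> {..<M} \<and>
          (\<forall>i. i + M < N \<longrightarrow> s (i + M) = mpoly_eval f (\<lambda>j. s (i + j))))))"

end

theory Submission
  imports Defs "HOL-Number_Theory.Cong"
begin

text \<open>
  Write \<open>p = p\<^sub>k\<close>. A shift \<open>X \<mapsto> X + m\<close> turns \<open>P\<close> into a monic polynomial \<open>Q\<close> with coefficients in the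
  natural numbers. Let \<open>c\<^sub>j(n) = Q\<^sup>(\<^sup>j\<^sup>)(n) / j!\<close>, so that
  \<open>Q(n + 2\<^sup>L t) = \<Sum>\<^sub>j c\<^sub>j(n) t\<^sup>j 2\<^sup>L\<^sup>j\<close>. Once \<open>L\<close> is large the summands occupy disjoint digit ranges separated
  by zeros, no block of ones crosses a separator, and hence
  \<open>p(Q(n + 2\<^sup>L t)) = \<Sum>\<^sub>j p(c\<^sub>j(n) t\<^sup>j)\<close> in the field with two elements. The right-hand side does not
  involve \<open>L\<close>. So the two windows of the sequence that start at \<open>2\<^sup>L\<close> and at \<open>2\<^sup>L\<^sup>+\<^sup>1\<close> agree at every
  offset \<open>h\<close> for which \<open>Q(h + 1) < 2\<^sup>L\<^sup>-\<^sup>1\<close>, that is, along a length of order \<open>2\<^sup>L\<^sup>/\<^sup>d\<close>. If moreover they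
  disagree at some offset \<open>O(2\<^sup>L)\<close>, then a recurrence that is shorter than the first such offset
  would have to produce different values from equal arguments; for \<open>N\<close> of order \<open>2\<^sup>L\<close> this is the
  claimed bound.

  The windows must disagree: otherwise the sequence would have period \<open>2\<^sup>L\<close> on a long stretch,
  and \<open>\<Sum>\<^sub>j p(c\<^sub>j(n) t\<^sup>j)\<close> would be independent of \<open>t \<ge> 1\<close> for every \<open>n\<close>. To refute this (lemma
  \<open>shifts_distinguishable\<close>), read it as the vanishing for all \<open>n\<close> of a finite sum of terms
  \<open>p(R(n))\<close>, where \<open>R\<close> runs through the polynomials \<open>c\<^sub>j t\<^sup>j\<close> and \<open>c\<^sub>j\<close> with \<open>j \<ge> 1\<close>. Such a relation can be
  differentiated: substituting \<open>n + 2\<^sup>L\<close> for \<open>n\<close> and subtracting the original relation leaves one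
  for the divided derivatives of positive order, whose degrees are smaller. Repeating this
  until only constants are left keeps just the leading coefficients
  (\<open>vanishing_family_leading_coeffs\<close>) and gives \<open>p(d! t) = p(d!)\<close> for all \<open>t \<ge> 1\<close>. But \<open>p\<close> takes both
  values on the positive multiples of \<open>d!\<close>: the value 0 at two widely separated copies of \<open>d!\<close>, and
  the value 1 by \<open>pattern_seq_multiple_eq_1\<close>.
\<close>

text \<open>Sums over the field with two elements are treated as additive identities below;
  rewriting addition to exclusive or would take them out of reach of the sum lemmas.\<close>

declare add_bit_eq_xor [simp del] mult_bit_eq_and [simp del]

lemma bit_double [simp]: "x + x = (0 :: bit)"
  by (cases x) (simp_all add: add_bit_eq_xor)

lemma bit_add_eq_0_iff: "x + y = (0 :: bit) \<longleftrightarrow> x = y"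
  by (cases x; cases y) (simp_all add: add_bit_eq_xor)

section \<open>Pattern sequences and binary digits\<close>

lemma finite_block_occurrences:
  assumes "k \<ge> 1"
  shows "finite {i. \<forall>j<k. Bit_Operations.bit (n :: nat) (i + j)}"
proof (rule finite_subset)
  show "{i. \<forall>j<k. Bit_Operations.bit n (i + j)} \<subseteq> {..<n}"
  proof safe
    fix i assume "\<forall>j<k. Bit_Operations.bit n (i + j)"
    hence "Bit_Operations.bit n i" using assms by (metis add.right_neutral less_eq_Suc_le One_nat_def)
    hence "2 ^ i \<le> n" by (metis bit_nat_iff bit_iff_odd div_less even_zero leI)
    thus "i < n" using less_exp[of i] by linarith
  qed
qed simp

lemma bit_append:
  fixes a b l p :: nat
  assumes "a < 2 ^ l"
  shows "Bit_Operations.bit (a + 2 ^ Suc l * b) p \<longleftrightarrow>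
    (if p < Suc l then Bit_Operations.bit a p else Bit_Operations.bit b (p - Suc l))"
proof -
  have a: "a < 2 ^ Suc l" using assms by simp
  have "take_bit (Suc l) (a + 2 ^ Suc l * b) = a"
    using a by (simp only: take_bit_eq_mod mod_mult_self2 mod_less)
  moreover have "drop_bit (Suc l) (a + 2 ^ Suc l * b) = b"
    using a by (simp only: drop_bit_eq_div) (simp del: power_Suc)
  ultimately show ?thesis
    by (metis bit_drop_bit_eq bit_take_bit_iff comp_apply le_add_diff_inverse not_less)
qed

lemma bit_less_power:
  fixes a :: nat
  assumes "a < 2 ^ l" "l \<le> p"
  shows "\<not> Bit_Operations.bit a p"
proof -
  have "a < 2 ^ p" using assms by (meson less_le_trans one_le_numeral power_increasing)
  thus ?thesis by (simp add: bit_iff_odd)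
qed

text \<open>The digit at position \<open>l\<close> is a zero that separates the digits of \<open>a\<close> from those of \<open>b\<close>, so an
  occurrence of the block lies entirely in one of the two parts. Without this guard digit,
  blocks could straddle the boundary.\<close>

lemma block_count_append:
  assumes "k \<ge> 1" "a < 2 ^ l"
  shows "block_count k (a + 2 ^ Suc l * b) = block_count k a + block_count k b"
proof -
  let ?S = "\<lambda>n :: nat. {i. \<forall>j<k. Bit_Operations.bit n (i + j)}"
  note bits = bit_append[OF assms(2), of b]
  have "?S (a + 2 ^ Suc l * b) = ?S a \<union> (\<lambda>i. i + Suc l) ` ?S b"
  proof (intro equalityI subsetI)
    fix i assume i: "i \<in> ?S (a + 2 ^ Suc l * b)"
    show "i \<in> ?S a \<union> (\<lambda>i. i + Suc l) ` ?S b"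
    proof (cases "i < Suc l")
      case True
      (* Digit l is 0, so an occurrence starting at or below it must end before it. *)
      have "i + k \<le> l"
      proof (rule ccontr)
        assume "\<not> i + k \<le> l"
        hence "l - i < k" using True by auto
        hence "Bit_Operations.bit (a + 2 ^ Suc l * b) (i + (l - i))" using i by blast
        hence "Bit_Operations.bit a l" using True bits by auto
        thus False using bit_less_power[OF assms(2)] by blast
      qed
      hence "i \<in> ?S a" using i by (auto simp: bits simp del: power_Suc)
      thus ?thesis by blast
    next
      case False
      hence "i - Suc l \<in> ?S b" using i by (auto simp: bits simp del: power_Suc)
      thus ?thesis using False by (intro UnI2 image_eqI[of _ _ "i - Suc l"]) auto
    qed
  next
    fix i assume "i \<in> ?S a \<union> (\<lambda>i. i + Suc l) ` ?S b"
    thus "i \<in> ?S (a + 2 ^ Suc l * b)"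
    proof
      assume i: "i \<in> ?S a"
      have "i + j < Suc l" if "j < k" for j
        using i that bit_less_power[OF assms(2)] by (metis (mono_tags, lifting) mem_Collect_eq leI less_SucI)
      thus ?thesis using i by (auto simp: bits simp del: power_Suc)
    next
      assume "i \<in> (\<lambda>i. i + Suc l) ` ?S b"
      thus ?thesis by (auto simp: bits simp del: power_Suc)
    qed
  qed
  moreover have "?S a \<inter> (\<lambda>i. i + Suc l) ` ?S b = {}"
  proof (rule ccontr)
    assume "?S a \<inter> (\<lambda>i. i + Suc l) ` ?S b \<noteq> {}"
    then obtain i where "\<forall>j<k. Bit_Operations.bit a (i + Suc l + j)" by blast
    moreover have "0 < k" using assms(1) by simp
    ultimately have "Bit_Operations.bit a (i + Suc l + 0)" by blast
    thus False using bit_less_power[OF assms(2)] by simp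
  qed
  moreover have "card ((\<lambda>i. i + Suc l) ` ?S b) = card (?S b)"
    by (intro card_image) (auto simp: inj_on_def)
  ultimately show ?thesis
    unfolding block_count_def using finite_block_occurrences[OF assms(1)]
    by (simp only: card_Un_disjoint finite_imageI)
qed

lemma pattern_seq_eq: "pattern_seq k n = of_nat (block_count k n)"
proof -
  let ?c = "block_count k n"
  have "(of_nat ?c :: bit) = of_nat (2 * (?c div 2) + ?c mod 2)" by simp
  also have "\<dots> = of_nat (?c mod 2)" by (simp only: of_nat_add of_nat_mult of_nat_numeral bit_2_eq_0) simp
  finally show ?thesis by (simp add: pattern_seq_def)
qed

lemma pattern_seq_append:
  assumes "k \<ge> 1" "a < 2 ^ l"
  shows "pattern_seq k (a + 2 ^ Suc l * b) = pattern_seq k a + pattern_seq k b"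
  by (simp only: pattern_seq_eq block_count_append[OF assms] of_nat_add)

lemma pattern_seq_0 [simp]: "k \<ge> 1 \<Longrightarrow> pattern_seq k 0 = 0"
  by (auto simp: pattern_seq_eq block_count_def)

lemma pattern_seq_shift:
  assumes "k \<ge> 1"
  shows "pattern_seq k (2 ^ v * x) = pattern_seq k x"
proof (cases v)
  case (Suc l)
  show ?thesis using pattern_seq_append[OF assms, of 0 l x] assms by (simp add: Suc)
qed simp

lemma pattern_seq_digits:
  assumes "k \<ge> 1" "\<And>j. j < m \<Longrightarrow> a j < 2 ^ l"
  shows "pattern_seq k (\<Sum>j<m. a j * (2 ^ Suc l) ^ j) = (\<Sum>j<m. pattern_seq k (a j))"
  using assms(2)
proof (induction m arbitrary: a)
  case 0
  show ?case using assms(1) by simp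
next
  case (Suc m)
  have "(\<Sum>j<Suc m. a j * (2 ^ Suc l) ^ j) = a 0 + 2 ^ Suc l * (\<Sum>j<m. a (Suc j) * (2 ^ Suc l) ^ j)"
    by (simp only: sum.lessThan_Suc_shift) (simp add: sum_distrib_left mult_ac)
  hence "pattern_seq k (\<Sum>j<Suc m. a j * (2 ^ Suc l) ^ j) =
    pattern_seq k (a 0) + pattern_seq k (\<Sum>j<m. a (Suc j) * (2 ^ Suc l) ^ j)"
    using pattern_seq_append[OF assms(1)] Suc.prems by simp
  also have "\<dots> = pattern_seq k (a 0) + (\<Sum>j<m. pattern_seq k (a (Suc j)))"
    using Suc.IH[of "\<lambda>j. a (Suc j)"] Suc.prems by simp
  finally show ?case by (simp only: sum.lessThan_Suc_shift)
qed

lemma pattern_seq_block: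
  assumes "k \<ge> 1"
  shows "pattern_seq k (2 ^ k - 1) = 1"
proof -
  have b: "Bit_Operations.bit (2 ^ k - 1 :: nat) i \<longleftrightarrow> i < k" for i
    using bit_mask_iff[of k i, where ?'a = nat] by (simp add: mask_eq_exp_minus_1)
  have "(\<forall>j<k. i + j < k) \<longleftrightarrow> i = 0" for i
  proof
    assume "\<forall>j<k. i + j < k"
    moreover have "k - 1 < k" using assms by simp
    ultimately have "i + (k - 1) < k" by blast
    thus "i = 0" by simp
  qed simp
  hence "{i. \<forall>j<k. Bit_Operations.bit (2 ^ k - 1 :: nat) (i + j)} = {0}"
    unfolding b by blast
  thus ?thesis unfolding pattern_seq_eq block_count_def by simp
qed

text \<open>Two of the powers \<open>2\<^sup>0, \<dots>, 2\<^sup>E\<close> share a residue, and 2 can be cancelled modulo an odd number.\<close>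

lemma power2_cong_1_of_odd:
  fixes E :: nat
  assumes "odd E"
  obtains r where "r \<ge> 1" "[2 ^ r = 1] (mod E)"
proof -
  have "E > 0" using assms by (cases E) auto
  hence "(\<lambda>i. 2 ^ i mod E) ` {..E} \<subseteq> {..<E}" by auto
  hence "card ((\<lambda>i. 2 ^ i mod E) ` {..E}) < card {..E}"
    using card_mono[OF finite_lessThan, of "(\<lambda>i. 2 ^ i mod E) ` {..E}" E] by (simp add: less_Suc_eq_le)
  hence "\<not> inj_on (\<lambda>i. 2 ^ i mod E) {..E}" by (rule pigeonhole)
  then obtain i j where "i < j" and eq: "2 ^ i mod E = 2 ^ j mod E"
    using linorder_inj_onI'[of "{..E}" "\<lambda>i. 2 ^ i mod E"] by blast
  have "(2 :: nat) ^ i * 2 ^ (j - i) = 2 ^ j"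
    using \<open>i < j\<close> by (subst power_add[symmetric]) simp
  hence "[2 ^ i * 2 ^ (j - i) = 2 ^ i * 1] (mod E)"
    using eq by (simp only: cong_def mult_1_right)
  moreover have "coprime (2 ^ i) E" using assms by simp
  ultimately have "[2 ^ (j - i) = 1] (mod E)" by (simp only: cong_mult_lcancel_nat)
  thus thesis using \<open>i < j\<close> by (intro that[of "j - i"]) auto
qed

text \<open>Factors of 2 in \<open>D\<close> only shift digits, so let \<open>E\<close> be the odd part of \<open>D\<close>. Place \<open>E\<close> copies of the
  block \<open>2\<^sup>k - 1\<close> at positions that are multiples of a period of 2 modulo \<open>E\<close>. Modulo \<open>E\<close> all copies
  are equal, so their sum is divisible by \<open>E\<close>; and each copy contributes exactly one occurrence, so
  the number of occurrences is the odd number \<open>E\<close>.\<close>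

lemma pattern_seq_multiple_eq_1:
  assumes "k \<ge> 1" "D > 0"
  obtains t where "t \<ge> 1" "pattern_seq k (D * t) = 1"
proof -
  define v where "v = multiplicity 2 D"
  obtain E where D: "D = 2 ^ v * E" and odd: "odd E"
    unfolding v_def by (rule multiplicity_decompose'[of D 2]) (use assms(2) in auto)
  obtain r where r: "r \<ge> 1" "[2 ^ r = 1] (mod E)" using power2_cong_1_of_odd[OF odd] .
  (* The factor k + 1 makes the spacing exceed the length of the block. *)
  define l where "l = r * (k + 1) - 1"
  have L: "Suc l = r * (k + 1)" using r(1) by (simp add: l_def)
  have "k + 1 \<le> r * (k + 1)" using r(1) by (cases r) auto
  hence "k \<le> l" using L by linarith
  define x :: nat where "x = (\<Sum>i<E. (2 ^ k - 1) * (2 ^ Suc l) ^ i)"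
  have "(2 ^ k - 1 :: nat) < 2 ^ k" by simp
  also have "\<dots> \<le> (2 :: nat) ^ l" using \<open>k \<le> l\<close> by simp
  finally have "pattern_seq k x = (\<Sum>i<E. pattern_seq k (2 ^ k - 1))"
    unfolding x_def using assms(1) by (intro pattern_seq_digits) auto
  also have "\<dots> = of_nat E" by (simp only: pattern_seq_block[OF assms(1)]) simp
  also have "\<dots> = 1" using odd by (auto elim!: oddE)
  finally have x1: "pattern_seq k x = 1" .
  have "[(2 ^ r) ^ (k + 1) = 1 ^ (k + 1)] (mod E)" using r(2) by (rule cong_pow)
  hence c: "[2 ^ Suc l = 1] (mod E)" by (simp only: L power_mult power_one)
  have "[x = (\<Sum>i<E. (2 ^ k - 1) * 1 ^ i)] (mod E)"
    unfolding x_def by (intro cong_sum cong_mult cong_pow c cong_refl)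
  hence "[x = E * (2 ^ k - 1)] (mod E)" by simp
  hence "E dvd x" by (simp add: cong_def mod_eq_0_iff_dvd)
  then obtain t where t: "x = E * t" by blast
  have "t \<noteq> 0" using x1 t assms(1) by (cases t) auto
  moreover have "pattern_seq k (D * t) = 1"
    using x1 pattern_seq_shift[OF assms(1), of v x] by (simp add: D t mult.assoc)
  ultimately show thesis by (intro that[of t]) auto
qed

section \<open>Divided derivatives\<close>

text \<open>The \<open>j\<close>-th derivative divided by \<open>j!\<close>; the division is carried out on the binomial coefficients, so
  that the coefficients stay natural numbers.\<close>

definition hasse :: "nat \<Rightarrow> nat poly \<Rightarrow> nat poly" where
  "hasse j Q = (\<Sum>i\<le>degree Q. monom ((i choose j) * coeff Q i) (i - j))"

lemma coeff_hasse: "coeff (hasse j Q) i = ((i + j) choose j) * coeff Q (i + j)"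
proof -
  have "coeff (hasse j Q) i =
    (\<Sum>r\<le>degree Q. if r = i + j then (r choose j) * coeff Q r else 0)"
    unfolding hasse_def coeff_sum coeff_monom
    by (intro sum.cong refl) (auto simp: not_less)
  also have "\<dots> = ((i + j) choose j) * coeff Q (i + j)"
    by (simp add: coeff_eq_0)
  finally show ?thesis .
qed

lemma hasse_0 [simp]: "hasse 0 Q = Q"
  by (intro poly_eqI) (simp add: coeff_hasse)

lemma degree_hasse: "degree (hasse j Q) \<le> degree Q - j"
  by (rule degree_le) (auto simp: coeff_hasse coeff_eq_0)

lemma poly_nat_altdef:
  fixes Q :: "nat poly"
  assumes "degree Q \<le> m"
  shows "poly Q x = (\<Sum>i\<le>m. coeff Q i * x ^ i)"
  unfolding poly_altdef using assms
  by (intro sum.mono_neutral_left) (auto simp: coeff_eq_0)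

lemma poly_taylor:
  assumes "degree Q \<le> m"
  shows "poly Q (n + x) = (\<Sum>j\<le>m. poly (hasse j Q) n * x ^ j)"
proof -
  have h: "poly (hasse j Q) n = (\<Sum>i\<le>m. (i choose j) * coeff Q i * n ^ (i - j))" for j
  proof -
    have "poly (hasse j Q) n = (\<Sum>i\<le>degree Q. (i choose j) * coeff Q i * n ^ (i - j))"
      unfolding hasse_def by (simp add: poly_sum poly_monom)
    also have "\<dots> = (\<Sum>i\<le>m. (i choose j) * coeff Q i * n ^ (i - j))"
      using assms by (intro sum.mono_neutral_left) (auto simp: coeff_eq_0)
    finally show ?thesis .
  qed
  have "poly Q (n + x) = (\<Sum>i\<le>m. coeff Q i * (x + n) ^ i)"
    using poly_nat_altdef[OF assms] by (simp add: add.commute)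
  also have "\<dots> = (\<Sum>i\<le>m. \<Sum>j\<le>m. (i choose j) * coeff Q i * n ^ (i - j) * x ^ j)"
  proof (intro sum.cong refl)
    fix i assume "i \<in> {..m}"
    have "(x + n) ^ i = (\<Sum>j\<le>i. (i choose j) * x ^ j * n ^ (i - j))"
      by (simp add: binomial)
    also have "\<dots> = (\<Sum>j\<le>m. (i choose j) * x ^ j * n ^ (i - j))"
      using \<open>i \<in> {..m}\<close> by (intro sum.mono_neutral_left) auto
    finally show "coeff Q i * (x + n) ^ i =
        (\<Sum>j\<le>m. (i choose j) * coeff Q i * n ^ (i - j) * x ^ j)"
      by (simp add: sum_distrib_left mult_ac)
  qed
  also have "\<dots> = (\<Sum>j\<le>m. \<Sum>i\<le>m. (i choose j) * coeff Q i * n ^ (i - j) * x ^ j)"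
    by (rule sum.swap)
  also have "\<dots> = (\<Sum>j\<le>m. poly (hasse j Q) n * x ^ j)"
    by (simp only: h sum_distrib_right)
  finally show ?thesis .
qed

text \<open>The value \<open>Q(n + t)\<close> is the sum of all the terms \<open>c\<^sub>j(n) t\<^sup>j\<close>, hence bounding it bounds every term at
  once, and the Taylor expansion becomes a sum of separated digit ranges.\<close>

lemma pattern_seq_poly_shift:
  assumes "k \<ge> 1" "degree Q \<le> m" "poly Q (n + t) < 2 ^ l"
  shows "pattern_seq k (poly Q (n + 2 ^ Suc l * t)) =
    pattern_seq k (poly Q n) + (\<Sum>j=1..m. pattern_seq k (poly (hasse j Q) n * t ^ j))"
proof -
  have small: "poly (hasse j Q) n * t ^ j < 2 ^ l" if "j < Suc m" for j
  proof -
    have "poly (hasse j Q) n * t ^ j \<le> poly Q (n + t)"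
      unfolding poly_taylor[OF assms(2)] using that by (intro member_le_sum) auto
    thus ?thesis using assms(3) by (rule le_less_trans)
  qed
  have "poly Q (n + 2 ^ Suc l * t) = (\<Sum>j<Suc m. poly (hasse j Q) n * t ^ j * (2 ^ Suc l) ^ j)"
    unfolding poly_taylor[OF assms(2)] lessThan_Suc_atMost
    by (simp only: power_mult_distrib mult_ac)
  hence "pattern_seq k (poly Q (n + 2 ^ Suc l * t)) =
      (\<Sum>j<Suc m. pattern_seq k (poly (hasse j Q) n * t ^ j))"
    using pattern_seq_digits[OF assms(1), of "Suc m" "\<lambda>j. poly (hasse j Q) n * t ^ j" l] small
    by simp
  also have "\<dots> = pattern_seq k (poly Q n) + (\<Sum>j=1..m. pattern_seq k (poly (hasse j Q) n * t ^ j))"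
    by (simp only: sum.lessThan_Suc_shift)
       (simp add: sum.atLeast1_atMost_eq)
  finally show ?thesis .
qed

section \<open>Vanishing sums\<close>

lemma exists_power2_bound:
  fixes F :: "nat list"
  shows "\<exists>l. \<forall>x\<in>set F. x < 2 ^ l"
proof (intro exI ballI)
  fix x assume "x \<in> set F"
  hence "x \<le> sum_list F" by (intro member_le_sum_list) auto
  also have "\<dots> < 2 ^ sum_list F" by simp
  finally show "x < 2 ^ sum_list F" .
qed

lemma sum_list_concat_map:
  fixes f :: "'b \<Rightarrow> 'c :: comm_monoid_add"
  shows "sum_list (map f (concat (map g xs))) = (\<Sum>x\<leftarrow>xs. sum_list (map f (g x)))"
  by (induction xs) auto

text \<open>Differentiating the relation \<open>e\<close> times by means of \<open>pattern_seq_poly_shift\<close> leaves constants. A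
  polynomial of degree at most \<open>e\<close> gives a nonzero constant only if each step is a first
  derivative, because a step of order \<open>j\<close> lowers the degree by \<open>j\<close>; that constant is \<open>e!\<close> times its
  coefficient of degree \<open>e\<close>. A list is used, rather than a set, because equal polynomials must be
  counted with multiplicity.\<close>

lemma vanishing_family_leading_coeffs:
  assumes "k \<ge> 1"
    and "\<And>Q. Q \<in> set Qs \<Longrightarrow> degree Q \<le> e"
    and "\<And>n. (\<Sum>Q\<leftarrow>Qs. pattern_seq k (poly Q n)) = 0"
  shows "(\<Sum>Q\<leftarrow>Qs. pattern_seq k (fact e * coeff Q e)) = 0"
  using assms(2,3)
proof (induction e arbitrary: Qs)
  case 0
  show ?case using 0(2)[of 0] by (simp add: poly_0_coeff_0)
next
  case (Suc e)
  (* All divided derivatives of orders 1 to e + 1. *)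
  define Rs where "Rs = concat (map (\<lambda>Q. map (\<lambda>j. hasse j Q) [1..<Suc (Suc e)]) Qs)"
  have Rs: "(\<Sum>R\<leftarrow>Rs. f R) = (\<Sum>Q\<leftarrow>Qs. \<Sum>j=1..Suc e. f (hasse j Q))" for f :: "nat poly \<Rightarrow> bit"
    unfolding Rs_def sum_list_concat_map map_map comp_def
    by (subst sum_list_distinct_conv_sum_set)
       (simp_all add: atLeastLessThanSuc_atLeastAtMost del: upt_Suc)
  have "degree R \<le> e" if R: "R \<in> set Rs" for R
  proof -
    obtain Q j where "Q \<in> set Qs" "j \<ge> 1" "R = hasse j Q"
      using R unfolding Rs_def by (auto simp del: upt_Suc)
    thus ?thesis using degree_hasse[of j Q] Suc.prems(1)[of Q] by auto
  qed
  moreover have "(\<Sum>R\<leftarrow>Rs. pattern_seq k (poly R n)) = 0" for n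
  proof -
    obtain l where l: "\<forall>x\<in>set (map (\<lambda>Q. poly Q (n + 1)) Qs). x < 2 ^ l"
      using exists_power2_bound by blast
    have "pattern_seq k (poly Q (n + 2 ^ Suc l)) = pattern_seq k (poly Q n) +
        (\<Sum>j=1..Suc e. pattern_seq k (poly (hasse j Q) n))" if "Q \<in> set Qs" for Q
      using pattern_seq_poly_shift[OF assms(1) Suc.prems(1)[OF that], of n 1 l] l that by simp
    hence "(\<Sum>Q\<leftarrow>Qs. pattern_seq k (poly Q (n + 2 ^ Suc l))) =
        (\<Sum>Q\<leftarrow>Qs. pattern_seq k (poly Q n) + (\<Sum>j=1..Suc e. pattern_seq k (poly (hasse j Q) n)))"
      by (intro arg_cong[where f = sum_list] map_cong refl)
    thus ?thesis using Suc.prems(2) by (simp only: Rs sum_list_addf) simp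
  qed
  ultimately have "(\<Sum>R\<leftarrow>Rs. pattern_seq k (fact e * coeff R e)) = 0"
    by (rule Suc.IH)
  moreover have "(\<Sum>j=1..Suc e. pattern_seq k (fact e * coeff (hasse j Q) e)) =
      pattern_seq k (fact (Suc e) * coeff Q (Suc e))" if "Q \<in> set Qs" for Q
  proof -
    have "coeff (hasse j Q) e = 0" if "j > 1" for j
      using \<open>Q \<in> set Qs\<close> Suc.prems(1)[of Q] that by (simp add: coeff_hasse coeff_eq_0)
    hence "(\<Sum>j=1..Suc e. pattern_seq k (fact e * coeff (hasse j Q) e)) =
       (\<Sum>j\<in>{1}. pattern_seq k (fact e * coeff (hasse j Q) e))"
      using assms(1) by (intro sum.mono_neutral_right) auto
    also have "\<dots> = pattern_seq k (fact (Suc e) * coeff Q (Suc e))"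
      by (simp add: coeff_hasse algebra_simps)
    finally show ?thesis .
  qed
  ultimately show ?case unfolding Rs by (simp cong: map_cong)
qed

text \<open>By \<open>pattern_seq_poly_shift\<close>, the two sums decide whether the sequence \<open>p(Q(n))\<close> takes the same value
  at \<open>n + 2\<^sup>L t\<close> and at \<open>n + 2\<^sup>L\<close> for large \<open>L\<close>. If they always agreed, the previous lemma applied to the
  difference would force \<open>p(d! t) = p(d!)\<close> for all \<open>t \<ge> 1\<close>.\<close>

lemma shifts_distinguishable:
  fixes Q :: "nat poly"
  assumes "k \<ge> 1" "degree Q = d" "d \<ge> 1" "lead_coeff Q = 1"
  obtains n t where "t \<ge> 1"
    "(\<Sum>j=1..d. pattern_seq k (poly (hasse j Q) n * t ^ j)) \<noteq>
     (\<Sum>j=1..d. pattern_seq k (poly (hasse j Q) n))"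
proof (rule ccontr)
  assume "\<not> thesis"
  with that have eq: "(\<Sum>j=1..d. pattern_seq k (poly (hasse j Q) n * t ^ j)) =
     (\<Sum>j=1..d. pattern_seq k (poly (hasse j Q) n))" if "t \<ge> 1" for n t
    using that by blast
  obtain e where e: "d = Suc e" using assms(3) by (cases d) auto
  have const: "pattern_seq k (fact d * t) = pattern_seq k (fact d)" if "t \<ge> 1" for t
  proof -
    define Rs where "Rs = map (\<lambda>j. smult (t ^ j) (hasse j Q)) [1..<Suc d] @ map (\<lambda>j. hasse j Q) [1..<Suc d]"
    have Rs: "(\<Sum>R\<leftarrow>Rs. f R) = (\<Sum>j=1..d. f (smult (t ^ j) (hasse j Q))) + (\<Sum>j=1..d. f (hasse j Q))"
      for f :: "nat poly \<Rightarrow> bit"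
      unfolding Rs_def map_append sum_list_append map_map comp_def
      by (subst (1 2) sum_list_distinct_conv_sum_set)
         (simp_all add: atLeastLessThanSuc_atLeastAtMost del: upt_Suc)
    have deg: "degree (hasse j Q) \<le> e" if "j \<ge> 1" for j
      using degree_hasse[of j Q] assms(2) that e by simp
    have "(\<Sum>R\<leftarrow>Rs. pattern_seq k (fact e * coeff R e)) = 0"
    proof (rule vanishing_family_leading_coeffs[OF assms(1)])
      show "degree R \<le> e" if "R \<in> set Rs" for R
        using that deg unfolding Rs_def by (auto intro: order.trans[OF degree_smult_le])
      show "(\<Sum>R\<leftarrow>Rs. pattern_seq k (poly R n)) = 0" for n
        unfolding Rs using eq[OF that, of n] by (simp add: mult.commute)
    qed
    (* Only the first derivative reaches degree e = d - 1, with leading coefficient d. *)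
    moreover have "(\<Sum>j=1..d. f (coeff (hasse j Q) e) j) = f d 1"
      if "\<And>j. f 0 j = 0" for f :: "nat \<Rightarrow> nat \<Rightarrow> bit"
    proof -
      have "coeff (hasse j Q) e = 0" if "j > 1" for j
        using assms(2) e that by (simp add: coeff_hasse coeff_eq_0)
      hence "(\<Sum>j=1..d. f (coeff (hasse j Q) e) j) = (\<Sum>j\<in>{1}. f (coeff (hasse j Q) e) j)"
        using that e by (intro sum.mono_neutral_right) auto
      also have "\<dots> = f d 1" using assms(2,4) e by (simp add: coeff_hasse)
      finally show ?thesis .
    qed
    note this[of "\<lambda>c j. pattern_seq k (fact e * (t ^ j * c))"] this[of "\<lambda>c j. pattern_seq k (fact e * c)"]
    ultimately have "pattern_seq k (fact e * (t * d)) + pattern_seq k (fact e * d) = 0"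
      unfolding Rs using assms(1) by simp
    thus ?thesis using e by (simp add: bit_add_eq_0_iff algebra_simps)
  qed
  (* This multiple consists of two separated copies of d!, whose contributions cancel. *)
  have "pattern_seq k (fact d * (1 + 2 ^ Suc (fact d))) = pattern_seq k (fact d + 2 ^ Suc (fact d) * fact d)"
    by (simp add: algebra_simps)
  also have "\<dots> = 0" using pattern_seq_append[OF assms(1) less_exp, of "fact d" "fact d"] by simp
  finally have "pattern_seq k (fact d) = 0" using const[of "1 + 2 ^ Suc (fact d)"] by simp
  moreover obtain t where "t \<ge> 1" "pattern_seq k (fact d * t) = 1"
    using pattern_seq_multiple_eq_1[OF assms(1), of "fact d"] fact_gt_zero by blast
  ultimately show False using const by simp
qed


section \<open>Reduction to nonnegative coefficients\<close>

text \<open>The coefficients of \<open>P(n + X)\<close> are the divided derivatives of \<open>P\<close> at \<open>n\<close>, which are nonnegative for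
  large \<open>n\<close>. The induction follows \<open>P = a + X P\<^sub>1\<close>: the only coefficient of
  \<open>P(n + X) = a + n P\<^sub>1(n + X) + X P\<^sub>1(n + X)\<close> that \<open>a\<close> can spoil is the constant one, and there
  \<open>n P\<^sub>1(n) \<ge> n\<close> outweighs \<open>a\<close>. This is why the constant coefficient is claimed to be positive.\<close>

lemma pcompose_shift_coeffs_nonneg:
  fixes P :: "int poly"
  assumes "lead_coeff P > 0"
  shows "\<exists>m :: nat. \<forall>n \<ge> m. let R = pcompose P [:int n, 1:]
    in coeff R 0 > 0 \<and> (\<forall>i. coeff R i \<ge> 0)"
  using assms
proof (induction P)
  case 0
  thus ?case by simp
next
  case (pCons a P)
  show ?case
  proof (cases "P = 0")
    case True
    thus ?thesis using pCons.prems by (auto simp: Let_def pcompose_pCons coeff_pCons split: nat.splits)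
  next
    case False
    then obtain m where m: "\<And>n i. n \<ge> m \<Longrightarrow> coeff (pcompose P [:int n, 1:]) 0 > 0"
      "\<And>n i. n \<ge> m \<Longrightarrow> coeff (pcompose P [:int n, 1:]) i \<ge> 0"
      using pCons unfolding Let_def by auto
    show ?thesis
    proof (intro exI[of _ "max m (nat \<bar>a\<bar> + 1)"] allI impI, unfold Let_def, intro conjI allI)
      fix n i assume n: "n \<ge> max m (nat \<bar>a\<bar> + 1)"
      define R where "R = pcompose P [:int n, 1:]"
      have R: "coeff R 0 > 0" "\<And>i. coeff R i \<ge> 0" using m n unfolding R_def by auto
      have c: "pcompose (pCons a P) [:int n, 1:] = [:a:] + (smult (int n) R + pCons 0 R)"
        by (simp add: pcompose_pCons R_def)
      have "int n * 1 \<le> int n * coeff R 0" using R(1) by (intro mult_left_mono) auto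
      moreover have "a + int n > 0" using n by linarith
      ultimately show pos: "coeff (pcompose (pCons a P) [:int n, 1:]) 0 > 0" by (simp add: c)
      show "coeff (pcompose (pCons a P) [:int n, 1:]) i \<ge> 0"
        using pos R by (cases i) (auto simp: c)
    qed
  qed
qed

lemma eventually_nat_poly:
  fixes P :: "int poly"
  assumes "lead_coeff P > 0"
  obtains m :: nat and Q :: "nat poly"
  where "degree Q = degree P" "int (lead_coeff Q) = lead_coeff P"
    "\<And>n. poly P (int (m + n)) = int (poly Q n)"
proof -
  obtain m where m: "\<And>i. coeff (pcompose P [:int m, 1:]) i \<ge> 0"
    using pcompose_shift_coeffs_nonneg[OF assms] unfolding Let_def by blast
  define R where "R = pcompose P [:int m, 1:]"
  define Q where "Q = map_poly nat R"
  have c: "int (coeff Q i) = coeff R i" for i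
    using m[of i] by (simp add: Q_def coeff_map_poly R_def)
  have "degree Q = degree R"
  proof (rule antisym)
    show "degree Q \<le> degree R" by (rule degree_le) (metis c coeff_eq_0 of_nat_eq_0_iff)
    show "degree R \<le> degree Q" by (rule degree_le) (metis c coeff_eq_0 of_nat_0)
  qed
  moreover have "degree R = degree P" by (simp add: R_def degree_pcompose)
  moreover have "lead_coeff R = lead_coeff P" by (simp add: R_def lead_coeff_comp)
  moreover have "poly P (int (m + n)) = int (poly Q n)" for n
  proof -
    have "poly P (int (m + n)) = poly R (int n)" by (simp add: R_def poly_pcompose)
    also have "\<dots> = int (poly Q n)"
      by (simp add: poly_altdef \<open>degree Q = degree R\<close> flip: c)
    finally show ?thesis .
  qed
  ultimately show thesis using c by (intro that[of Q m]) auto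
qed

lemma nat_poly_le:
  fixes Q :: "nat poly"
  shows "poly Q (n + 1) \<le> poly Q 1 * (n + 1) ^ degree Q"
proof -
  have "poly Q (n + 1) \<le> (\<Sum>i\<le>degree Q. coeff Q i * (n + 1) ^ degree Q)"
    unfolding poly_altdef by (intro sum_mono mult_left_mono power_increasing) auto
  also have "\<dots> = poly Q 1 * (n + 1) ^ degree Q"
    by (simp only: poly_altdef[of Q 1] power_one mult_1_right sum_distrib_right)
  finally show ?thesis .
qed

section \<open>Maximum order complexity\<close>

lemma mpoly_eval_cong:
  assumes "mpoly_vars f \<subseteq> V" "\<And>v. v \<in> V \<Longrightarrow> x v = y v"
  shows "mpoly_eval f x = mpoly_eval f y"
proof -
  have "x v = y v" if "m \<in> Poly_Mapping.keys f" "v \<in> Poly_Mapping.keys m" for m v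
    using that assms unfolding mpoly_vars_def by blast
  thus ?thesis unfolding mpoly_eval_def by (intro sum.cong arg_cong2[where f = "(*)"] prod.cong refl) auto
qed

text \<open>A recurrence of length at most \<open>H\<close> computes the terms \<open>i + H\<close> and \<open>j + H\<close> from equal arguments. The
  two indices are kept away from the last position \<open>N - 1\<close> so that their different values exclude
  the special case of a constant initial segment.\<close>

lemma max_order_complexity_gt:
  assumes agree: "\<And>h. h < H \<Longrightarrow> s (i + h) = s (j + h)"
    and differ: "s (i + H) \<noteq> s (j + H)"
    and range: "i + H + 1 < N" "j + H + 1 < N"
  shows "max_order_complexity s N > H"
proof -
  define good where "good M \<longleftrightarrow> 0 < M \<and> (\<exists>f :: bit mpolynomial. mpoly_vars f \<subseteq> {..<M} \<and>
          (\<forall>i. i + M < N \<longrightarrow> s (i + M) = mpoly_eval f (\<lambda>j. s (i + j))))" for M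
  have "i + H \<le> N - 2" "j + H \<le> N - 2" using range by auto
  hence "\<not> (\<exists>a. \<forall>i\<le>N - 2. s i = a)" using differ by metis
  hence eq: "max_order_complexity s N = (LEAST M. good M)"
    unfolding max_order_complexity_def good_def by (simp only: if_False)
  have "good N" unfolding good_def using range by (auto intro!: exI[of _ 0] simp: mpoly_vars_def)
  hence "good (LEAST M. good M)" by (rule LeastI)
  moreover have "\<not> good M" if "M \<le> H" for M
  proof
    assume "good M"
    then obtain f :: "bit mpolynomial" where f: "mpoly_vars f \<subseteq> {..<M}"
      "\<And>i. i + M < N \<Longrightarrow> s (i + M) = mpoly_eval f (\<lambda>j. s (i + j))"
      unfolding good_def by blast
    have "s (i + H) = mpoly_eval f (\<lambda>v. s (i + (H - M) + v))"
      using f(2)[of "i + (H - M)"] that range by simp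
    also have "\<dots> = mpoly_eval f (\<lambda>v. s (j + (H - M) + v))"
    proof (rule mpoly_eval_cong[OF f(1)])
      fix v assume "v \<in> {..<M}"
      thus "s (i + (H - M) + v) = s (j + (H - M) + v)"
        using agree[of "H - M + v"] that by (simp add: add.assoc)
    qed
    also have "\<dots> = s (j + H)" using f(2)[of "j + (H - M)"] that range by simp
    finally show False using differ by contradiction
  qed
  ultimately show ?thesis unfolding eq using not_le by blast
qed

section \<open>The lower bound\<close>

text \<open>The offset \<open>H\<close> is the first disagreement of the windows at \<open>2\<^sup>l\<^sup>+\<^sup>1\<close> and \<open>2\<^sup>l\<^sup>+\<^sup>2\<close>. It is not too small
  because for \<open>Q(h + 1) < 2\<^sup>l\<close> both values at offset \<open>h\<close> are given by the same sum. It exists and is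
  \<open>O(2\<^sup>l)\<close> because otherwise stepping from \<open>n + 2\<^sup>l\<^sup>+\<^sup>1\<close> in steps of \<open>2\<^sup>l\<^sup>+\<^sup>1\<close> to \<open>n + 2\<^sup>l\<^sup>+\<^sup>1 t\<close> would never
  change the value, contrary to \<open>shifts_distinguishable\<close>.\<close>

lemma pattern_seq_poly_windows:
  fixes Q :: "nat poly"
  assumes "k \<ge> 1" "degree Q \<ge> 1" "lead_coeff Q = 1"
  obtains B l\<^sub>0 where "\<And>l. l \<ge> l\<^sub>0 \<Longrightarrow> \<exists>H \<le> 2 ^ l * B. 2 ^ l \<le> poly Q (H + 1) \<and>
    pattern_seq k (poly Q (2 ^ Suc l + H)) \<noteq> pattern_seq k (poly Q (2 ^ Suc (Suc l) + H)) \<and>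
    (\<forall>h<H. pattern_seq k (poly Q (2 ^ Suc l + h)) = pattern_seq k (poly Q (2 ^ Suc (Suc l) + h)))"
proof -
  let ?p = "\<lambda>n. pattern_seq k (poly Q n)"
  define d where "d = degree Q"
  obtain n t where t: "t \<ge> 1" and
    diff: "(\<Sum>j=1..d. pattern_seq k (poly (hasse j Q) n * t ^ j)) \<noteq>
      (\<Sum>j=1..d. pattern_seq k (poly (hasse j Q) n))"
    by (rule shifts_distinguishable[OF assms(1) d_def[symmetric]]) (use assms in \<open>auto simp: d_def\<close>)
  have shift: "?p (n + 2 ^ Suc l * u) =
      ?p n + (\<Sum>j=1..d. pattern_seq k (poly (hasse j Q) n * u ^ j))"
    if "poly Q (n + u) < 2 ^ l" for n u l
    using that by (intro pattern_seq_poly_shift[OF assms(1)]) (simp_all add: d_def)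
  define l\<^sub>0 where "l\<^sub>0 = poly Q (n + 1) + poly Q (n + t)"
  show thesis
  proof (rule that[of l\<^sub>0 "n + 2 * t"])
    fix l assume "l \<ge> l\<^sub>0"
    hence "(2 :: nat) ^ l\<^sub>0 \<le> 2 ^ l" by (intro power_increasing) auto
    hence "l\<^sub>0 < 2 ^ l" using less_exp[of l\<^sub>0] by linarith
    hence "?p (n + 2 ^ Suc l * 1) \<noteq> ?p (n + 2 ^ Suc l * t)"
      using diff by (subst (1 2) shift) (simp_all add: l\<^sub>0_def)
    define differs where "differs h \<longleftrightarrow> ?p (2 ^ Suc l + h) \<noteq> ?p (2 ^ Suc (Suc l) + h)" for h
    have "\<exists>u<t. differs (n + 2 ^ Suc l * u)"
    proof (rule ccontr)
      assume "\<not> ?thesis"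
      hence step: "?p (n + 2 ^ Suc l * Suc u) = ?p (n + 2 ^ Suc l * Suc (Suc u))" if "u < t" for u
        using that unfolding differs_def by (auto simp: algebra_simps)
      have "?p (n + 2 ^ Suc l * Suc u) = ?p (n + 2 ^ Suc l * 1)" if "u \<le> t" for u
        using that
      proof (induction u)
        case (Suc u)
        thus ?case using step[of u] by (simp only: Suc_le_eq less_imp_le)
      qed simp
      from this[of "t - 1"] t \<open>?p (n + 2 ^ Suc l * 1) \<noteq> ?p (n + 2 ^ Suc l * t)\<close>
      show False by simp
    qed
    then obtain u where u: "u < t" "differs (n + 2 ^ Suc l * u)" by blast
    define H where "H = (LEAST h. differs h)"
    have H: "differs H" unfolding H_def using u(2) by (rule LeastI)
    have least: "\<not> differs h" if "h < H" for h using that not_less_Least unfolding H_def by blast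
    have "H \<le> n + 2 ^ Suc l * u" unfolding H_def using u(2) by (rule Least_le)
    also have "\<dots> \<le> 2 ^ l * n + 2 ^ Suc l * t"
      using u(1) by (intro add_mono mult_left_mono) auto
    finally have "H \<le> 2 ^ l * (n + 2 * t)" by (simp add: algebra_simps)
    moreover have "2 ^ l \<le> poly Q (H + 1)"
    proof (rule ccontr)
      assume "\<not> ?thesis"
      hence "poly Q (H + 1) < 2 ^ l" "poly Q (H + 1) < 2 ^ Suc l" by auto
      from shift[OF this(1)] shift[OF this(2)] have "\<not> differs H"
        unfolding differs_def by (simp add: add.commute)
      thus False using H by contradiction
    qed
    ultimately show "\<exists>H \<le> 2 ^ l * (n + 2 * t). 2 ^ l \<le> poly Q (H + 1) \<and>
        ?p (2 ^ Suc l + H) \<noteq> ?p (2 ^ Suc (Suc l) + H) \<and>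
        (\<forall>h<H. ?p (2 ^ Suc l + h) = ?p (2 ^ Suc (Suc l) + h))"
      using H least unfolding differs_def by blast
  qed
qed

theorem theorem4:
  fixes k d :: nat and P :: "int poly"
  assumes "k \<ge> 1" and "d \<ge> 2"
    and "degree P = d" and "lead_coeff P = 1"
    and "\<And>n :: nat. poly P (int n) \<ge> 0"
  shows "\<exists>c > 0. \<exists>N\<^sub>0 :: nat. \<forall>N \<ge> N\<^sub>0.
    real (max_order_complexity (\<lambda>n. pattern_seq k (nat (poly P (int n)))) N)
      \<ge> c * real N powr (1 / real d)"
proof -
  obtain m and Q :: "nat poly" where Q: "degree Q = d" "lead_coeff Q = 1"
    and PQ: "\<And>n. poly P (int (m + n)) = int (poly Q n)"
    using eventually_nat_poly[of P] assms(3,4) by (metis of_nat_eq_1_iff zero_less_one)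
  define s where "s = (\<lambda>n. pattern_seq k (nat (poly P (int n))))"
  have s: "s (m + n) = pattern_seq k (poly Q n)" for n
    unfolding s_def PQ by simp
  obtain B l\<^sub>0 where "\<And>l. l \<ge> l\<^sub>0 \<Longrightarrow> \<exists>H \<le> 2 ^ l * B. 2 ^ l \<le> poly Q (H + 1) \<and>
    pattern_seq k (poly Q (2 ^ Suc l + H)) \<noteq> pattern_seq k (poly Q (2 ^ Suc (Suc l) + H)) \<and>
    (\<forall>h<H. pattern_seq k (poly Q (2 ^ Suc l + h)) = pattern_seq k (poly Q (2 ^ Suc (Suc l) + h)))"
    by (rule pattern_seq_poly_windows[of k Q]) (use assms(1,2) Q in auto)
  hence windows: "\<exists>H \<le> 2 ^ l * B. 2 ^ l \<le> poly Q (H + 1) \<and>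
    s (m + 2 ^ Suc l + H) \<noteq> s (m + 2 ^ Suc (Suc l) + H) \<and>
    (\<forall>h<H. s (m + 2 ^ Suc l + h) = s (m + 2 ^ Suc (Suc l) + h))" if "l \<ge> l\<^sub>0" for l
    using that unfolding s add.assoc by blast
  (* Chosen so that m + 2 ^ (l + 2) + H + 2 <= 2 ^ l * C: both windows at level l, with their
     first disagreement, lie among the first 2 ^ l * C terms. *)
  define C where "C = m + B + 6"
  define A where "A = poly Q 1"
  have "A > 0"
  proof -
    have "coeff Q d \<le> A" unfolding A_def poly_altdef Q(1) by (simp add: member_le_sum)
    thus ?thesis using Q by simp
  qed
  define c where "c = (1 / (2 * real C * real A)) powr (1 / real d)"
  have "c > 0" using \<open>A > 0\<close> by (simp add: c_def C_def)
  moreover have "c * real N powr (1 / real d) \<le> real (max_order_complexity s N)"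
    if N: "N \<ge> C * 2 ^ l\<^sub>0" for N
  proof -
    have NC: "2 ^ l\<^sub>0 \<le> N div C" using N by (simp add: less_eq_div_iff_mult_less_eq C_def mult.commute)
    hence "N div C \<ge> 1" using one_le_power[of "2::nat" l\<^sub>0] by linarith
    then obtain l where l: "2 ^ l \<le> N div C" "N div C < 2 ^ (l + 1)"
      using ex_power_ivl1[of 2 "N div C"] by auto
    have "(2 :: nat) ^ l\<^sub>0 < 2 ^ (l + 1)" using NC l(2) by linarith
    hence "l \<ge> l\<^sub>0" by (simp del: power_Suc add: power_strict_increasing_iff)
    then obtain H where H: "H \<le> 2 ^ l * B" "2 ^ l \<le> poly Q (H + 1)"
      "s (m + 2 ^ Suc l + H) \<noteq> s (m + 2 ^ Suc (Suc l) + H)"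
      "\<And>h. h < H \<Longrightarrow> s (m + 2 ^ Suc l + h) = s (m + 2 ^ Suc (Suc l) + h)"
      using windows by blast
    have "m + 2 ^ Suc (Suc l) + H + 2 \<le> 2 ^ l * m + 2 ^ l * 4 + 2 ^ l * B + 2 ^ l * 2"
      using H(1) by (intro add_mono) auto
    also have "\<dots> = 2 ^ l * C" by (simp add: C_def algebra_simps)
    also have "\<dots> \<le> N" using l(1) by (simp add: less_eq_div_iff_mult_less_eq C_def mult.commute)
    finally have range: "m + 2 ^ Suc (Suc l) + H + 1 < N" by simp
    have "max_order_complexity s N > H"
      using H(3,4) range by (intro max_order_complexity_gt[where i = "m + 2 ^ Suc l"]) auto
    hence le: "real (H + 1) \<le> real (max_order_complexity s N)" by simp
    have "N < 2 ^ (l + 1) * C" using l(2) by (simp add: div_less_iff_less_mult C_def)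
    also have "\<dots> \<le> 2 * C * poly Q (H + 1)" using H(2) by simp
    also have "\<dots> \<le> 2 * C * (A * (H + 1) ^ d)"
      using nat_poly_le[of Q H] Q(1) by (intro mult_left_mono) (auto simp: A_def)
    finally have "real N \<le> real (2 * C * (A * (H + 1) ^ d))" by linarith
    hence "real N \<le> 2 * real C * real A * real (H + 1) ^ d"
      by (simp only: of_nat_mult of_nat_power of_nat_numeral mult.assoc)
    moreover have "2 * real C * real A > 0" using \<open>A > 0\<close> by (simp add: C_def)
    ultimately have "1 / (2 * real C * real A) * real N \<le> real (H + 1) ^ d"
      by (simp add: pos_divide_le_eq mult.commute)
    hence "(1 / (2 * real C * real A) * real N) powr (1 / real d) \<le> (real (H + 1) ^ d) powr (1 / real d)"
      by (intro powr_mono2) auto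
    also have "\<dots> = real (H + 1)"
      using assms(2) by (simp add: powr_powr flip: powr_realpow)
    finally have "c * real N powr (1 / real d) \<le> real (H + 1)"
      unfolding c_def by (simp only: powr_mult)
    thus ?thesis using le by linarith
  qed
  ultimately show ?thesis unfolding s_def by blast
qed

end
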